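(* Let $U$ be a subset of $F^1_{USCG}(X)$. Then $U$ is relatively compact in $(F^1_{USCG}(X), H_{\rm end})$ if and only if $U(\alpha)$ is relatively compact in $(X,d)$ for each $\alpha\in(0,1]$.
   Context: $(X,d)$ is a nonempty metric space. $X\times[0,1]$ carries the metric $\overline d((x,\alpha),(y,\beta))=d(x,y)+|\alpha-\beta|$. A fuzzy set in $X$ is a function $u:X\to[0,1]$. Its $\alpha$-cuts are $[u]_\alpha=\{x\in X: u(x)\ge\alpha\}$ for $\alpha\in(0,1]$ and $[u]_0=\overline{\{x\in X:u(x)>0\}}$ (closure in $X$). $C(Y)$ and $K(Y)$ denote the sets of nonempty closed, respectively nonempty compact, subsets of a metric space $Y$. $F^1_{USC}(X)$ is the set of fuzzy sets $u$ in $X$ with $[u]_\alpha\in C(X)$ for all $\alpha\in[0,1]$; $F^1_{USCG}(X)$ is the set of $u\in F^1_{USC}(X)$ with $[u]_\alpha\in K(X)$ for all $\alpha\in(0,1]$. For nonempty closed sets $A,B$, $H^*(A,B)=\sup_{a\in A}\inf_{b\in B}\rho(a,b)$ and $H(A,B)=\max\{H^*(A,B),H^*(B,A)\}$ is the Hausdorff distance, where $\rho$ is the underlying metric ($d$ on $X$, $\overline d$ on $X\times[0,1]$). The endograph is ${\rm end}\,u=\{(x,t)\in X\times[0,1]:u(x)\ge t\}$, and $H_{\rm end}(u,v)=H({\rm end}\,u,{\rm end}\,v)$ (computed with $\overline d$), which is a metric on $F^1_{USC}(X)$. For a set $U$ of fuzzy sets, $U(\alpha)=\bigcup_{u\in U}[u]_\alpha$.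 A subset of a metric space is relatively compact if its closure in that space is compact. *)

theory Defs
  imports "HOL-Analysis.Analysis"
begin

text \<open>
  The metric space \<open>X\<close> is a type of class \<^class>\<open>metric_space\<close> (types are nonempty). Fuzzy sets are
  real-valued functions on it; the families \<open>F1_USC\<close> and \<open>F1_USCG\<close> carry the constraint that the
  values lie in \<open>[0,1]\<close>.
\<close>

definition fuzzy_set :: "('a \<Rightarrow> real) \<Rightarrow> bool" where
  "fuzzy_set u \<longleftrightarrow> (\<forall>x. u x \<in> {0..1})"

definition cut :: "('a::metric_space \<Rightarrow> real) \<Rightarrow> real \<Rightarrow> 'a set" where
  "cut u \<alpha> = (if \<alpha> = 0 then closure {x. u x > 0} else {x. u x \<ge> \<alpha>})"

definition F1_USC :: "('a::metric_space \<Rightarrow> real) set" where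
  "F1_USC = {u. fuzzy_set u \<and> (\<forall>\<alpha>\<in>{0..1}. cut u \<alpha> \<noteq> {} \<and> closed (cut u \<alpha>))}"

definition F1_USCG :: "('a::metric_space \<Rightarrow> real) set" where
  "F1_USCG = {u \<in> F1_USC. \<forall>\<alpha>\<in>{0<..1}. cut u \<alpha> \<noteq> {} \<and> compact (cut u \<alpha>)}"

text \<open>
  The one-sided and the symmetric Hausdorff distance with respect to a distance function \<open>\<rho>\<close>. They
  take values in \<open>[0,\<infinity>]\<close>, since the supremum is infinite for some pairs of unbounded sets.
\<close>

definition Hausdorff_excess :: "('b \<Rightarrow> 'b \<Rightarrow> real) \<Rightarrow> 'b set \<Rightarrow> 'b set \<Rightarrow> ennreal" where
  "Hausdorff_excess \<rho> A B = (SUP a\<in>A. INF b\<in>B. ennreal (\<rho> a b))"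

definition Hausdorff_dist :: "('b \<Rightarrow> 'b \<Rightarrow> real) \<Rightarrow> 'b set \<Rightarrow> 'b set \<Rightarrow> ennreal" where
  "Hausdorff_dist \<rho> A B = max (Hausdorff_excess \<rho> A B) (Hausdorff_excess \<rho> B A)"

text \<open>
  The sum metric on \<open>X \<times> [0,1]\<close>; the library's \<^const>\<open>dist\<close> on pairs is the Euclidean combination
  of the two distances instead.
\<close>

definition sum_dist :: "'a::metric_space \<times> real \<Rightarrow> 'a \<times> real \<Rightarrow> real" where
  "sum_dist p q = dist (fst p) (fst q) + \<bar>snd p - snd q\<bar>"

definition endograph :: "('a \<Rightarrow> real) \<Rightarrow> ('a \<times> real) set" where
  "endograph u = {(x, t). t \<in> {0..1} \<and> u x \<ge> t}"

text \<open>
  On \<open>F1_USC\<close> the Hausdorff distance of endographs is at most 1 (\<open>Hausdorff_endograph_le_1\<close> below),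
  so that \<^const>\<open>enn2real\<close> loses nothing.
\<close>

definition H_end :: "('a::metric_space \<Rightarrow> real) \<Rightarrow> ('a \<Rightarrow> real) \<Rightarrow> real" where
  "H_end u v = enn2real (Hausdorff_dist sum_dist (endograph u) (endograph v))"

definition level_union :: "('a::metric_space \<Rightarrow> real) set \<Rightarrow> real \<Rightarrow> 'a set" where
  "level_union U \<alpha> = (\<Union>u\<in>U. cut u \<alpha>)"

definition relatively_compactin :: "'b topology \<Rightarrow> 'b set \<Rightarrow> bool" where
  "relatively_compactin T S \<longleftrightarrow> S \<subseteq> topspace T \<and> compactin T (T closure_of S)"

lemma relatively_compactin_euclidean:
  "relatively_compactin euclidean S \<longleftrightarrow> compact (closure S)"
  by (simp add: relatively_compactin_def)

text \<open>
  \<^term>\<open>Metric_space.mtopology F1_USCG H_end\<close> is the topology of a metric space only if \<^const>\<open>H_end\<close>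
  satisfies the metric axioms. The rest of this theory proves this.
\<close>

lemma INF_ennreal_add_const_on:
  fixes f :: "'b \<Rightarrow> ennreal"
  assumes "I \<noteq> {}"
  shows "(INF i\<in>I. f i + c) = (INF i\<in>I. f i) + c"
  using continuous_at_Inf_mono[of "\<lambda>x. x + c" "f ` I"] assms
  using continuous_add[of "at_right (Inf (f ` I))", of "\<lambda>x. x" "\<lambda>x. c"]
  by (auto simp: mono_def image_comp)

lemma Hausdorff_excess_triangle:
  assumes tri: "\<And>a b c. \<rho> a c \<le> \<rho> a b + \<rho> b c" and nn: "\<And>a b. 0 \<le> \<rho> a b"
  shows "Hausdorff_excess \<rho> A C \<le> Hausdorff_excess \<rho> A B + Hausdorff_excess \<rho> B C"
  unfolding Hausdorff_excess_def[of \<rho> A C]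
proof (rule SUP_least)
  fix a assume a: "a \<in> A"
  let ?k = "Hausdorff_excess \<rho> B C"
  have step: "(INF c\<in>C. ennreal (\<rho> a c)) \<le> ennreal (\<rho> a b) + ?k" if b: "b \<in> B" for b
  proof (cases "C = {}")
    case True
    then have "?k = top" using b by (auto simp: Hausdorff_excess_def)
    then show ?thesis by simp
  next
    case False
    have "(INF c\<in>C. ennreal (\<rho> a c)) \<le> (INF c\<in>C. ennreal (\<rho> b c) + ennreal (\<rho> a b))"
      by (rule INF_mono) (metis tri nn ennreal_leI ennreal_plus add.commute)
    also have "\<dots> = (INF c\<in>C. ennreal (\<rho> b c)) + ennreal (\<rho> a b)"
      using False by (rule INF_ennreal_add_const_on)
    also have "\<dots> \<le> ?k + ennreal (\<rho> a b)"
      unfolding Hausdorff_excess_def by (intro add_right_mono SUP_upper b)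
    finally show ?thesis by (simp add: add.commute)
  qed
  show "(INF c\<in>C. ennreal (\<rho> a c)) \<le> Hausdorff_excess \<rho> A B + ?k"
  proof (cases "B = {}")
    case True
    then have "Hausdorff_excess \<rho> A B = top" using a by (auto simp: Hausdorff_excess_def)
    then show ?thesis by simp
  next
    case False
    have "(INF c\<in>C. ennreal (\<rho> a c)) \<le> (INF b\<in>B. ennreal (\<rho> a b) + ?k)"
      by (intro INF_greatest step)
    also have "\<dots> = (INF b\<in>B. ennreal (\<rho> a b)) + ?k"
      using False by (rule INF_ennreal_add_const_on)
    also have "\<dots> \<le> Hausdorff_excess \<rho> A B + ?k"
      unfolding Hausdorff_excess_def by (intro add_right_mono SUP_upper a)
    finally show ?thesis .
  qed
qed

lemma Hausdorff_dist_triangle: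
  assumes "\<And>a b c. \<rho> a c \<le> \<rho> a b + \<rho> b c" and "\<And>a b. 0 \<le> \<rho> a b"
  shows "Hausdorff_dist \<rho> A C \<le> Hausdorff_dist \<rho> A B + Hausdorff_dist \<rho> B C"
proof -
  have 1: "Hausdorff_excess \<rho> A C \<le> Hausdorff_dist \<rho> A B + Hausdorff_dist \<rho> B C"
    by (rule order.trans[OF Hausdorff_excess_triangle[where B=B, OF assms]])
       (auto intro!: add_mono simp: Hausdorff_dist_def)
  have 2: "Hausdorff_excess \<rho> C A \<le> Hausdorff_dist \<rho> B C + Hausdorff_dist \<rho> A B"
    by (rule order.trans[OF Hausdorff_excess_triangle[where B=B, OF assms]])
       (auto intro!: add_mono simp: Hausdorff_dist_def)
  show ?thesis using 1 2 by (auto simp: Hausdorff_dist_def[of \<rho> A C] add.commute)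
qed

lemma sum_dist_nonneg: "0 \<le> sum_dist p q"
  by (simp add: sum_dist_def)

lemma sum_dist_triangle: "sum_dist p r \<le> sum_dist p q + sum_dist q r"
  using dist_triangle[of "fst p" "fst r" "fst q"] by (simp add: sum_dist_def)

lemma Hausdorff_excess_endograph_le_1:
  assumes "fuzzy_set v"
  shows "Hausdorff_excess sum_dist (endograph u) (endograph v) \<le> 1"
  unfolding Hausdorff_excess_def
proof (rule SUP_least)
  fix p assume p: "p \<in> endograph u"
  obtain x t where pt: "p = (x, t)" by (cases p)
  with p have "t \<in> {0..1}" by (auto simp: endograph_def)
  moreover have "(x, 0) \<in> endograph v"
    using assms by (auto simp: endograph_def fuzzy_set_def)
  ultimately show "(INF q\<in>endograph v. ennreal (sum_dist p q)) \<le> 1"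
    by (intro INF_lower2[of "(x,0)"]) (auto simp: pt sum_dist_def)
qed

lemma Hausdorff_endograph_le_1:
  assumes "u \<in> F1_USC" "v \<in> F1_USC"
  shows "Hausdorff_dist sum_dist (endograph u) (endograph v) \<le> 1"
  using assms by (simp add: Hausdorff_dist_def F1_USC_def Hausdorff_excess_endograph_le_1)

lemma Hausdorff_excess_endograph_eq_0:
  assumes u: "u \<in> F1_USC" and v: "v \<in> F1_USC"
    and 0: "Hausdorff_excess sum_dist (endograph u) (endograph v) = 0"
  shows "u x \<le> v x"
proof (rule ccontr)
  assume "\<not> u x \<le> v x"
  define r where "r = (u x + v x) / 2"
  have r: "v x < r" "r < u x" using \<open>\<not> u x \<le> v x\<close> by (auto simp: r_def)
  have b: "0 \<le> v x" "u x \<le> 1" "0 \<le> u x"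
    using u v by (auto simp: F1_USC_def fuzzy_set_def)
  have "closed (cut v r)" using v r b by (auto simp: F1_USC_def)
  moreover have cut: "cut v r = {y. v y \<ge> r}" using r b by (simp add: cut_def)
  ultimately have "open (- {y. v y \<ge> r})" by (simp add: open_Compl)
  moreover have "x \<in> - {y. v y \<ge> r}" using r by simp
  ultimately obtain e where e: "e > 0" "ball x e \<subseteq> - {y. v y \<ge> r}"
    using openE by blast
  define \<delta> where "\<delta> = min e (u x - r)"
  have \<delta>: "\<delta> > 0" using e r by (simp add: \<delta>_def)
  have "(x, u x) \<in> endograph u" using b by (simp add: endograph_def)
  then have "(INF q\<in>endograph v. ennreal (sum_dist (x, u x) q)) \<le> 0"
    unfolding 0[symmetric] Hausdorff_excess_def by (rule SUP_upper)
  also have "\<dots> < ennreal \<delta>" using \<delta> by simp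
  finally obtain y s where q: "(y, s) \<in> endograph v" "ennreal (sum_dist (x, u x) (y, s)) < ennreal \<delta>"
    by (auto simp: INF_less_iff)
  then have lt: "dist x y + \<bar>u x - s\<bar> < \<delta>"
    using \<delta> by (subst (asm) ennreal_less_iff) (auto simp: sum_dist_def)
  then have "dist x y < e" "s > r"
    using zero_le_dist[of x y] abs_ge_self[of "u x - s"] abs_ge_zero[of "u x - s"]
      min.cobounded1[of e "u x - r"] min.cobounded2[of e "u x - r"]
    unfolding \<delta>_def by linarith+
  then have "v y \<ge> r" "y \<in> ball x e" using q by (auto simp: endograph_def)
  then show False using e by auto
qed

lemma Metric_space_F1_USC: "Metric_space (F1_USC :: ('a::metric_space \<Rightarrow> real) set) H_end"
proof
  fix u v w :: "'a \<Rightarrow> real"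
  let ?H = "\<lambda>u v :: 'a \<Rightarrow> real. Hausdorff_dist sum_dist (endograph u) (endograph v)"
  show "0 \<le> H_end u v" by (simp add: H_end_def)
  show "H_end u v = H_end v u" by (simp add: H_end_def Hausdorff_dist_def max.commute)
  have fin: "?H u v < top" if "u \<in> F1_USC" "v \<in> F1_USC" for u v
    using Hausdorff_endograph_le_1[OF that] ennreal_one_less_top le_less_trans by blast
  show "H_end u v = 0 \<longleftrightarrow> u = v" if uv: "u \<in> F1_USC" "v \<in> F1_USC"
  proof
    assume "H_end u v = 0"
    then have "?H u v = 0" using fin[OF uv] by (auto simp: H_end_def enn2real_eq_0_iff)
    then have "Hausdorff_excess sum_dist (endograph u) (endograph v) = 0"
      "Hausdorff_excess sum_dist (endograph v) (endograph u) = 0"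
      by (auto simp: Hausdorff_dist_def max_def split: if_splits)
    then show "u = v"
      using Hausdorff_excess_endograph_eq_0 uv by (intro ext antisym) auto
  next
    assume "u = v"
    have "Hausdorff_excess sum_dist (endograph v) (endograph v) \<le> 0"
      unfolding Hausdorff_excess_def
    proof (rule SUP_least)
      fix p assume "p \<in> endograph v"
      then show "(INF q\<in>endograph v. ennreal (sum_dist p q)) \<le> 0"
        by (rule INF_lower2) (simp add: sum_dist_def)
    qed
    then show "H_end u v = 0" by (simp add: H_end_def Hausdorff_dist_def \<open>u = v\<close>)
  qed
  show "H_end u w \<le> H_end u v + H_end v w" if "u \<in> F1_USC" "v \<in> F1_USC" "w \<in> F1_USC"
  proof -
    have "?H u w \<le> ?H u v + ?H v w"
      by (intro Hausdorff_dist_triangle sum_dist_triangle sum_dist_nonneg)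
    then have "enn2real (?H u w) \<le> enn2real (?H u v + ?H v w)"
      using fin that by (intro enn2real_mono) auto
    also have "\<dots> = enn2real (?H u v) + enn2real (?H v w)"
      using fin that by (intro enn2real_plus) auto
    finally show ?thesis by (simp add: H_end_def)
  qed
qed

lemma Metric_space_F1_USCG: "Metric_space (F1_USCG :: ('a::metric_space \<Rightarrow> real) set) H_end"
  by (rule Metric_space.subspace[OF Metric_space_F1_USC]) (auto simp: F1_USCG_def)

end

theory Submission
  imports Defs
begin

text \<open>
  Both directions work with sequences. Two endographs are close exactly when every point
  on the graph of either function lies nearly below the graph of the other, after a small
  horizontal move (\<open>endo_near\<close>); this elementary relation replaces the Hausdorff distance throughout.

  If \<open>U\<close> is relatively compact and \<open>x\<^sub>n\<close> lies in the \<open>\<alpha>\<close>-cut of \<open>u\<^sub>n \<in> U\<close>, pass to a subsequence with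
  \<open>u\<^sub>n \<longlonglongrightarrow> u\<close>. The points \<open>x\<^sub>n\<close> then have distance tending to \<open>0\<close> from the \<open>\<alpha>/2\<close>-cut of \<open>u\<close>, which is
  compact, so they cluster.

  Conversely, suppose that all \<open>U(\<alpha>)\<close> are relatively compact. Two facts combine.

  \<^item> \<open>U\<close> is totally bounded (\<open>mtotally_bounded_of_level_unions\<close>). Below height \<open>\<delta>\<close> any two endographs
  agree up to \<open>\<delta>\<close>, because they contain \<open>X \<times> {0}\<close>; above height \<open>\<delta>\<close> they live over the totally bounded
  set \<open>U(\<delta>)\<close>, so a finite grid of mesh \<open>\<delta>\<close> determines them up to a multiple of \<open>\<delta>\<close>.

  \<^item> Every Cauchy sequence in \<open>U\<close> converges in \<open>F1_USCG\<close> (\<open>endo_Cauchy_convergent\<close>). The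
  limit is the function whose endograph is the Kuratowski lower limit of the given endographs. The
  relative compactness of \<open>U(\<alpha>)\<close> supplies cluster points, which make the limit attain \<open>1\<close> and keep
  it close to the sequence, and it makes the cuts of the limit compact.
\<close>

section \<open>Relative compactness through sequences\<close>

text \<open>
  The limits are taken in the whole space, so the closure does not have to be described: the
  Bolzano-Weierstrass property of the closure only concerns infinite subsets of \<open>S\<close>.
\<close>
lemma (in Metric_space) relatively_compactin_sequentially:
  "relatively_compactin mtopology S \<longleftrightarrow>
    S \<subseteq> M \<and> (\<forall>\<sigma>::nat \<Rightarrow> 'a. range \<sigma> \<subseteq> S \<longrightarrow>
      (\<exists>l r. strict_mono r \<and> limitin mtopology (\<sigma> \<circ> r) l sequentially))"
proof (cases "S \<subseteq> M")
  case True
  have "(\<forall>T. T \<subseteq> S \<and> infinite T \<longrightarrow> M \<inter> mtopology derived_set_of T \<noteq> {}) \<longleftrightarrow>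
      compactin mtopology (mtopology closure_of S)"
    unfolding compact_closure_of_eq_Bolzano_Weierstrass
    using True derived_set_of_subset_topspace[of mtopology]
    by (metis inf.absorb2 order_trans topspace_mtopology)
  then show ?thesis
    using True Bolzano_Weierstrass_property[OF True True] limitin_mspace
    unfolding relatively_compactin_def by (metis topspace_mtopology)
qed (simp add: relatively_compactin_def)

lemma relatively_compactin_euclidean_sequentially:
  fixes S :: "'a::metric_space set"
  shows "relatively_compactin euclidean S \<longleftrightarrow>
    (\<forall>\<sigma>::nat \<Rightarrow> 'a. range \<sigma> \<subseteq> S \<longrightarrow> (\<exists>l r. strict_mono r \<and> (\<sigma> \<circ> r) \<longlonglongrightarrow> l))"
  using Met_TC.relatively_compactin_sequentially[of S] by (simp add: o_def)

section \<open>Closeness of endographs\<close>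

text \<open>
  Up to a factor of \<open>2\<close> in \<open>e\<close> this bounds the one-sided Hausdorff distance from the endograph of
  \<open>u\<close> to that of \<open>v\<close> by \<open>e\<close>. Only the top point \<open>(x, u x)\<close> over each \<open>x\<close> matters, since endographs are closed downwards.
\<close>
definition endo_near :: "real \<Rightarrow> ('a::metric_space \<Rightarrow> real) \<Rightarrow> ('a \<Rightarrow> real) \<Rightarrow> bool" where
  "endo_near e u v \<longleftrightarrow> (\<forall>x. \<exists>y. dist x y < e \<and> u x - e < v y)"

lemma F1_USCG_bounds:
  assumes "u \<in> F1_USCG" shows "0 \<le> u x" "u x \<le> 1"
  using assms by (auto simp: F1_USCG_def F1_USC_def fuzzy_set_def)

lemma in_cut_iff: "0 < \<alpha> \<Longrightarrow> x \<in> cut u \<alpha> \<longleftrightarrow> \<alpha> \<le> u x"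
  by (simp add: cut_def)

lemma in_level_unionI: "0 < \<alpha> \<Longrightarrow> u \<in> U \<Longrightarrow> \<alpha> \<le> u x \<Longrightarrow> x \<in> level_union U \<alpha>"
  by (auto simp: level_union_def in_cut_iff)

lemma endo_near_of_H_end_less:
  assumes uv: "u \<in> F1_USCG" "v \<in> F1_USCG" and less: "H_end u v < e"
  shows "endo_near e u v"
  unfolding endo_near_def
proof
  fix x
  let ?h = "Hausdorff_dist sum_dist (endograph u) (endograph v)"
  have "?h \<le> 1"
    using uv by (intro Hausdorff_endograph_le_1) (auto simp: F1_USCG_def)
  then have "?h = ennreal (H_end u v)"
    unfolding H_end_def by (metis ennreal_enn2real ennreal_one_less_top order_le_less_trans)
  moreover have "0 \<le> H_end u v"
    by (simp add: H_end_def)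
  ultimately have "?h < ennreal e"
    using less by (simp add: ennreal_less_iff)
  have "(x, u x) \<in> endograph u"
    using F1_USCG_bounds[OF uv(1)] by (simp add: endograph_def)
  then have "(INF q\<in>endograph v. ennreal (sum_dist (x, u x) q))
      \<le> Hausdorff_excess sum_dist (endograph u) (endograph v)"
    unfolding Hausdorff_excess_def by (rule SUP_upper)
  also have "\<dots> \<le> ?h"
    by (simp add: Hausdorff_dist_def)
  also note \<open>?h < ennreal e\<close>
  finally obtain y s where q: "(y, s) \<in> endograph v" "ennreal (sum_dist (x, u x) (y, s)) < ennreal e"
    by (auto simp: INF_less_iff)
  then have "dist x y + \<bar>u x - s\<bar> < e"
    by (subst (asm) ennreal_less_iff) (auto simp: sum_dist_def)
  moreover have "s \<le> v y"
    using q by (simp add: endograph_def)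
  ultimately have "dist x y < e \<and> u x - e < v y"
    using zero_le_dist[of x y] by linarith
  then show "\<exists>y. dist x y < e \<and> u x - e < v y" ..
qed

lemma Hausdorff_excess_le_of_endo_near:
  assumes uv: "u \<in> F1_USCG" "v \<in> F1_USCG" and near: "endo_near e u v"
  shows "Hausdorff_excess sum_dist (endograph u) (endograph v) \<le> ennreal (2 * e)"
  unfolding Hausdorff_excess_def
proof (rule SUP_least)
  fix p assume "p \<in> endograph u"
  then obtain x t where p: "p = (x, t)" "0 \<le> t" "t \<le> u x" "t \<le> 1"
    by (auto simp: endograph_def)
  obtain y where y: "dist x y < e" "u x - e < v y"
    using near by (auto simp: endo_near_def)
  have "(y, min t (v y)) \<in> endograph v"
    using F1_USCG_bounds[OF uv(2)] p by (auto simp: endograph_def min_def)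
  moreover have "sum_dist p (y, min t (v y)) \<le> 2 * e"
    using y p order_le_less_trans[OF zero_le_dist y(1)] by (simp add: sum_dist_def min_def)
  ultimately show "(INF q\<in>endograph v. ennreal (sum_dist p q)) \<le> ennreal (2 * e)"
    by (intro INF_lower2[of "(y, min t (v y))"]) (auto intro: ennreal_leI)
qed

lemma H_end_le_of_endo_near:
  assumes uv: "u \<in> F1_USCG" "v \<in> F1_USCG" and "0 \<le> e" "endo_near e u v" "endo_near e v u"
  shows "H_end u v \<le> 2 * e"
proof -
  have "Hausdorff_dist sum_dist (endograph u) (endograph v) \<le> ennreal (2 * e)"
    using assms by (simp add: Hausdorff_dist_def Hausdorff_excess_le_of_endo_near)
  then show ?thesis
    unfolding H_end_def using \<open>0 \<le> e\<close> by (intro enn2real_leI) auto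
qed

section \<open>Relatively compact families have relatively compact level unions\<close>

text \<open>
  The points of the compact cut of the limit \<open>u\<close> that lie close to the given points \<open>x\<close> have a
  convergent subsequence, and the \<open>x\<close> follow. The level drops from \<open>\<alpha>\<close> to \<open>\<alpha>/2\<close> because
  closeness of endographs preserves heights only approximately.
\<close>
lemma level_union_relatively_compact:
  fixes U :: "('a::metric_space \<Rightarrow> real) set"
  assumes rc: "relatively_compactin (Metric_space.mtopology F1_USCG H_end) U"
    and \<alpha>: "0 < \<alpha>" "\<alpha> \<le> 1"
  shows "relatively_compactin euclidean (level_union U \<alpha>)"
  unfolding relatively_compactin_euclidean_sequentially
proof (intro allI impI)
  interpret E: Metric_space "F1_USCG :: ('a \<Rightarrow> real) set" H_end
    by (rule Metric_space_F1_USCG)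
  fix x :: "nat \<Rightarrow> 'a"
  assume "range x \<subseteq> level_union U \<alpha>"
  then have "\<forall>n. \<exists>u\<in>U. \<alpha> \<le> u (x n)"
    using \<alpha> by (fastforce simp: level_union_def in_cut_iff)
  then obtain w where w: "\<And>n. w n \<in> U" "\<And>n. \<alpha> \<le> w n (x n)"
    by metis
  obtain u r where r: "strict_mono r" and lim: "limitin E.mtopology (w \<circ> r) u sequentially"
    using rc w(1) unfolding E.relatively_compactin_sequentially by (metis image_subset_iff)
  have u: "u \<in> F1_USCG"
    using lim E.limitin_mspace by blast
  \<comment> \<open>The extra summand makes the bound on the distance strict.\<close>
  define \<delta> where "\<delta> k = H_end (w (r k)) u + inverse (Suc k)" for k
  have "\<delta> \<longlonglongrightarrow> 0"
    using tendsto_add[OF _ LIMSEQ_inverse_real_of_nat] lim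
    by (fastforce simp: \<delta>_def[abs_def] E.limitin_metric_dist_null o_def)
  have "\<exists>y. dist (x (r k)) y < \<delta> k \<and> \<alpha> - \<delta> k < u y" for k
  proof -
    have "w (r k) \<in> F1_USCG"
      using w(1) rc by (auto simp: E.relatively_compactin_sequentially)
    then have "endo_near (\<delta> k) (w (r k)) u"
      using u by (rule endo_near_of_H_end_less) (simp add: \<delta>_def)
    then show ?thesis
      using w(2)[of "r k"] unfolding endo_near_def by (smt (verit))
  qed
  then obtain y where y: "\<And>k. dist (x (r k)) (y k) < \<delta> k" "\<And>k. \<alpha> - \<delta> k < u (y k)"
    by metis
  have "\<forall>\<^sub>F k in sequentially. \<delta> k < \<alpha> / 2"
    using \<open>\<delta> \<longlonglongrightarrow> 0\<close> \<alpha> by (intro order_tendstoD(2)[of _ 0]) auto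
  then obtain N where N: "\<And>k. k \<ge> N \<Longrightarrow> \<delta> k < \<alpha> / 2"
    by (auto simp: eventually_sequentially)
  have "y (k + N) \<in> cut u (\<alpha>/2)" for k
    using y(2)[of "k + N"] N[of "k + N"] \<alpha> by (simp add: in_cut_iff)
  moreover have "compact (cut u (\<alpha>/2))"
    using u \<alpha> by (simp add: F1_USCG_def)
  ultimately obtain l s where s: "strict_mono s" and l: "((\<lambda>k. y (k + N)) \<circ> s) \<longlonglongrightarrow> l"
    unfolding compact_eq_seq_compact_metric seq_compact_def by (metis (no_types, lifting))
  define q where "q k = s k + N" for k
  have q: "strict_mono q"
    using s by (simp add: q_def strict_mono_def)
  have sum: "(\<lambda>k. \<delta> (q k) + dist (y (q k)) l) \<longlonglongrightarrow> 0 + 0"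
    using l LIMSEQ_subseq_LIMSEQ[OF \<open>\<delta> \<longlonglongrightarrow> 0\<close> q]
    by (intro tendsto_add) (simp_all add: tendsto_dist_iff[of _ l] o_def q_def)
  have "norm (dist (x (r (q k))) l) \<le> \<delta> (q k) + dist (y (q k)) l" for k
    using dist_triangle[of "x (r (q k))" l "y (q k)"] y(1)[of "q k"] by simp
  then have "(\<lambda>k. dist (x (r (q k))) l) \<longlonglongrightarrow> 0"
    by (intro Lim_null_comparison[OF always_eventually sum[unfolded add_0_right]] allI)
  then have "(x \<circ> (r \<circ> q)) \<longlonglongrightarrow> l"
    unfolding tendsto_dist_iff[of _ l] o_def .
  then show "\<exists>l r. strict_mono r \<and> (x \<circ> r) \<longlonglongrightarrow> l"
    using strict_mono_o[OF r q] by blast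
qed

section \<open>Limits of Cauchy sequences of endographs\<close>

text \<open>
  For \<open>t \<in> {0..1}\<close> and fuzzy sets \<open>\<sigma> n\<close>, this says that \<open>(x, t)\<close> belongs to the Kuratowski lower
  limit of the endographs of the \<open>\<sigma> n\<close>. The
  point near \<open>(x, t)\<close> is only asked to have height above \<open>t - e\<close>, not within \<open>e\<close> of \<open>t\<close>, because
  endographs are closed downwards.
\<close>
definition in_lower_limit :: "(nat \<Rightarrow> 'a::metric_space \<Rightarrow> real) \<Rightarrow> real \<Rightarrow> 'a \<Rightarrow> bool" where
  "in_lower_limit \<sigma> t x \<longleftrightarrow>
    (\<forall>e>0. \<forall>\<^sub>F n in sequentially. \<exists>y. dist x y < e \<and> t - e < \<sigma> n y)"

definition endo_limit :: "(nat \<Rightarrow> 'a::metric_space \<Rightarrow> real) \<Rightarrow> 'a \<Rightarrow> real" where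
  "endo_limit \<sigma> x = Sup {t \<in> {0..1}. in_lower_limit \<sigma> t x}"

lemma in_lower_limitD:
  "in_lower_limit \<sigma> t x \<Longrightarrow> 0 < e \<Longrightarrow> \<forall>\<^sub>F n in sequentially. \<exists>y. dist x y < e \<and> t - e < \<sigma> n y"
  by (simp add: in_lower_limit_def)

lemma in_lower_limit_zero:
  assumes nonneg: "\<And>n x. 0 \<le> \<sigma> n x"
  shows "in_lower_limit \<sigma> 0 x"
  unfolding in_lower_limit_def
proof (intro allI impI always_eventually)
  fix e :: real and n assume "0 < e"
  then have "dist x x < e \<and> 0 - e < \<sigma> n x"
    using nonneg[of n x] by simp
  then show "\<exists>y. dist x y < e \<and> 0 - e < \<sigma> n y" ..
qed

lemma in_lower_limit_closed:
  assumes "\<And>e. 0 < e \<Longrightarrow> \<exists>x' t'. dist x x' < e \<and> t - e < t' \<and> in_lower_limit \<sigma> t' x'"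
  shows "in_lower_limit \<sigma> t x"
  unfolding in_lower_limit_def
proof (intro allI impI)
  fix e :: real assume "0 < e"
  then obtain x' t' where x': "dist x x' < e/2" "t - e/2 < t'" "in_lower_limit \<sigma> t' x'"
    using assms[of "e/2"] by auto
  then have "\<forall>\<^sub>F n in sequentially. \<exists>y. dist x' y < e/2 \<and> t' - e/2 < \<sigma> n y"
    using half_gt_zero[OF \<open>0 < e\<close>] by (blast dest: in_lower_limitD)
  then show "\<forall>\<^sub>F n in sequentially. \<exists>y. dist x y < e \<and> t - e < \<sigma> n y"
  proof (rule eventually_mono)
    fix n assume "\<exists>y. dist x' y < e/2 \<and> t' - e/2 < \<sigma> n y"
    then obtain y where "dist x' y < e/2" "t' - e/2 < \<sigma> n y"
      by blast
    then have "dist x y < e \<and> t - e < \<sigma> n y"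
      using x' dist_triangle[of x y x'] by linarith
    then show "\<exists>y. dist x y < e \<and> t - e < \<sigma> n y" ..
  qed
qed

text \<open>
  The supremum in the definition of the limit function is attained, because the Kuratowski limit is
  closed. Hence the endograph of the limit function is the Kuratowski limit itself.
\<close>
lemma le_endo_limit_iff:
  assumes nonneg: "\<And>n x. 0 \<le> \<sigma> n x" and t: "0 \<le> t" "t \<le> 1"
  shows "t \<le> endo_limit \<sigma> x \<longleftrightarrow> in_lower_limit \<sigma> t x"
proof
  let ?L = "{t \<in> {0..1}. in_lower_limit \<sigma> t x}"
  have bdd: "bdd_above ?L"
    by (intro bdd_aboveI[of _ 1]) auto
  show "t \<le> endo_limit \<sigma> x" if "in_lower_limit \<sigma> t x"
    unfolding endo_limit_def using bdd t that by (intro cSup_upper) auto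
  have "?L \<noteq> {}"
    using in_lower_limit_zero[of \<sigma> x, OF nonneg] by force
  show "in_lower_limit \<sigma> t x" if le: "t \<le> endo_limit \<sigma> x"
  proof (rule in_lower_limit_closed)
    fix e :: real assume "0 < e"
    then have "t - e < Sup ?L"
      using le by (simp add: endo_limit_def)
    then obtain t' where "t - e < t'" "in_lower_limit \<sigma> t' x"
      using less_cSup_iff[OF \<open>?L \<noteq> {}\<close> bdd] by auto
    then show "\<exists>x' t'. dist x x' < e \<and> t - e < t' \<and> in_lower_limit \<sigma> t' x'"
      using \<open>0 < e\<close> by (intro exI[of _ x] exI[of _ t']) simp
  qed
qed

lemma endo_limit_bounds:
  assumes "\<And>n x. 0 \<le> \<sigma> n x"
  shows "0 \<le> endo_limit \<sigma> x" "endo_limit \<sigma> x \<le> 1"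
proof -
  show "0 \<le> endo_limit \<sigma> x"
    using le_endo_limit_iff[of \<sigma> 0 x, OF assms] in_lower_limit_zero[of \<sigma> x, OF assms] by simp
  have "{t \<in> {0..1}. in_lower_limit \<sigma> t x} \<noteq> {}"
    using in_lower_limit_zero[of \<sigma> x, OF assms] by force
  then show "endo_limit \<sigma> x \<le> 1"
    unfolding endo_limit_def by (intro cSup_least) auto
qed

definition endo_Cauchy :: "(nat \<Rightarrow> 'a::metric_space \<Rightarrow> real) \<Rightarrow> bool" where
  "endo_Cauchy \<sigma> \<longleftrightarrow> (\<forall>e>0. \<exists>N. \<forall>m\<ge>N. \<forall>n\<ge>N. endo_near e (\<sigma> m) (\<sigma> n))"

text \<open>
  For a Cauchy sequence the Kuratowski upper and lower limits agree: a point approached by a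
  subsequence of the endographs is approached by the whole sequence, because all late endographs
  are close to each other.
\<close>
lemma in_lower_limit_of_cluster_point:
  assumes Cauchy: "endo_Cauchy \<sigma>" and idx: "filterlim r at_top sequentially"
    and lim: "y \<longlonglongrightarrow> x" and height: "\<And>k. t \<le> \<sigma> (r k) (y k)"
  shows "in_lower_limit \<sigma> t x"
  unfolding in_lower_limit_def
proof (intro allI impI)
  fix e :: real assume "0 < e"
  then obtain N where N: "\<And>m n. m \<ge> N \<Longrightarrow> n \<ge> N \<Longrightarrow> endo_near (e/2) (\<sigma> m) (\<sigma> n)"
    using Cauchy half_gt_zero unfolding endo_Cauchy_def by metis
  have "\<forall>\<^sub>F k in sequentially. r k \<ge> N \<and> dist (y k) x < e/2"
    using idx tendstoD[OF lim half_gt_zero[OF \<open>0 < e\<close>]]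
    by (intro eventually_conj) (simp_all add: filterlim_at_top)
  then obtain k where k: "r k \<ge> N" "dist (y k) x < e/2"
    using eventually_happens trivial_limit_sequentially by blast
  show "\<forall>\<^sub>F n in sequentially. \<exists>y. dist x y < e \<and> t - e < \<sigma> n y"
  proof (rule eventually_sequentiallyI)
    fix n assume "n \<ge> N"
    then obtain z where z: "dist (y k) z < e/2" "\<sigma> (r k) (y k) - e/2 < \<sigma> n z"
      using N[OF k(1)] unfolding endo_near_def by blast
    have "dist x z < e \<and> t - e < \<sigma> n z"
      using z k(2) height[of k] dist_triangle3[of x z "y k"] \<open>0 < e\<close> by linarith
    then show "\<exists>y. dist x y < e \<and> t - e < \<sigma> n y" ..
  qed
qed

text \<open>
  Relative compactness of the level unions is used three times. It puts the \<open>\<alpha>\<close>-cut of the limit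
  inside the compact closure of \<open>U(\<alpha>/2)\<close>. It makes the points where \<open>\<sigma> n\<close> attains \<open>1\<close> cluster, so
  that the limit attains \<open>1\<close>. And for a point of one endograph it makes its close companions in the
  later endographs cluster, which gives a point of the limit near it. The converse closeness, of
  the limit to the sequence, comes from the Cauchy property: approximate a point of the limit by a
  point of some late endograph, at a stage that depends on the point, and move from there to
  \<open>\<sigma> n\<close> at a uniform cost.
\<close>
lemma endo_Cauchy_convergent:
  fixes \<sigma> :: "nat \<Rightarrow> 'a::metric_space \<Rightarrow> real"
  assumes mem: "\<And>n. \<sigma> n \<in> F1_USCG" and Cauchy: "endo_Cauchy \<sigma>"
    and rc: "\<And>\<alpha>. 0 < \<alpha> \<Longrightarrow> \<alpha> \<le> 1 \<Longrightarrow> relatively_compactin euclidean (level_union (range \<sigma>) \<alpha>)"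
  shows "\<exists>u\<in>F1_USCG. \<forall>e>0. \<forall>\<^sub>F n in sequentially. endo_near e (\<sigma> n) u \<and> endo_near e u (\<sigma> n)"
proof -
  define u where "u = endo_limit \<sigma>"
  note bounds = F1_USCG_bounds[OF mem]
  have u_iff: "t \<le> u x \<longleftrightarrow> in_lower_limit \<sigma> t x" if "0 \<le> t" "t \<le> 1" for t x
    unfolding u_def using le_endo_limit_iff[of \<sigma>] bounds that by blast
  have u_bounds: "0 \<le> u x" "u x \<le> 1" for x
    unfolding u_def using endo_limit_bounds[of \<sigma>] bounds by blast+
  have cluster: "\<exists>x s. strict_mono s \<and> (y \<circ> s) \<longlonglongrightarrow> x \<and> t \<le> u x"
    if t: "0 < t" "t \<le> 1" and r: "strict_mono r" and height: "\<And>k. t \<le> \<sigma> (r k) (y k)"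
    for t and r :: "nat \<Rightarrow> nat" and y :: "nat \<Rightarrow> 'a"
  proof -
    have "range y \<subseteq> level_union (range \<sigma>) t"
      using t height by (auto intro: in_level_unionI)
    then obtain x s where s: "strict_mono s" "(y \<circ> s) \<longlonglongrightarrow> x"
      using rc[OF t] unfolding relatively_compactin_euclidean_sequentially by blast
    have "in_lower_limit \<sigma> t x"
      by (rule in_lower_limit_of_cluster_point[OF Cauchy _ s(2), of "r \<circ> s"])
        (use height filterlim_subseq[OF strict_mono_o[OF r s(1)]] in auto)
    then show ?thesis
      using s u_iff t by auto
  qed
  have closed_cut: "closed (cut u \<alpha>)" if \<alpha>: "0 < \<alpha>" "\<alpha> \<le> 1" for \<alpha>
  proof -
    have "x \<in> cut u \<alpha>" if "x \<in> closure (cut u \<alpha>)" for x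
    proof -
      have "\<exists>x' t'. dist x x' < e \<and> \<alpha> - e < t' \<and> in_lower_limit \<sigma> t' x'" if "0 < e" for e
        using \<open>x \<in> closure _\<close> \<open>0 < e\<close> \<alpha> u_iff[of \<alpha>]
        unfolding closure_approachable by (force simp: in_cut_iff dist_commute)
      then have "in_lower_limit \<sigma> \<alpha> x"
        by (rule in_lower_limit_closed)
      then show ?thesis
        using u_iff \<alpha> by (simp add: in_cut_iff)
    qed
    then show ?thesis
      by (metis closure_subset closure_closed subsetI subset_antisym closed_closure)
  qed
  have compact_cut: "compact (cut u \<alpha>)" if \<alpha>: "0 < \<alpha>" "\<alpha> \<le> 1" for \<alpha>
  proof -
    \<comment> \<open>A point at height \<open>\<alpha>\<close> of the limit is approached by points of height at least \<open>\<alpha>/2\<close>.\<close>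
    have "x \<in> closure (level_union (range \<sigma>) (\<alpha>/2))" if "x \<in> cut u \<alpha>" for x
      unfolding closure_approachable
    proof (intro allI impI)
      fix e :: real assume "0 < e"
      have "in_lower_limit \<sigma> \<alpha> x"
        using that \<alpha> u_iff by (simp add: in_cut_iff)
      then have "\<forall>\<^sub>F n in sequentially. \<exists>y. dist x y < min e (\<alpha>/2) \<and> \<alpha> - min e (\<alpha>/2) < \<sigma> n y"
        by (rule in_lower_limitD) (use \<open>0 < e\<close> \<alpha> in simp)
      then obtain n y where "dist x y < min e (\<alpha>/2)" "\<alpha> - min e (\<alpha>/2) < \<sigma> n y"
        using eventually_happens trivial_limit_sequentially by blast
      then have "y \<in> level_union (range \<sigma>) (\<alpha>/2)" "dist y x < e"
        using \<alpha> by (auto intro!: in_level_unionI[of _ "\<sigma> n"] simp: dist_commute)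
      then show "\<exists>y\<in>level_union (range \<sigma>) (\<alpha>/2). dist y x < e" by blast
    qed
    then have "cut u \<alpha> = closure (level_union (range \<sigma>) (\<alpha>/2)) \<inter> cut u \<alpha>"
      by blast
    moreover have "compact (closure (level_union (range \<sigma>) (\<alpha>/2)))"
      using rc[of "\<alpha>/2"] \<alpha> by (simp add: relatively_compactin_euclidean)
    ultimately show ?thesis
      using closed_cut[OF \<alpha>] compact_Int_closed by metis
  qed
  \<comment> \<open>Each \<open>\<sigma> n\<close> takes the value \<open>1\<close> somewhere, and these places cluster.\<close>
  have "\<exists>x. 1 \<le> u x"
  proof -
    have "\<exists>y. 1 \<le> \<sigma> n y" for n
    proof -
      have "cut (\<sigma> n) 1 \<noteq> {}"
        using mem[of n] by (simp add: F1_USCG_def)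
      then show ?thesis
        by (auto simp: in_cut_iff)
    qed
    then obtain y where "\<And>n. 1 \<le> \<sigma> n (y n)"
      by metis
    then show ?thesis
      using cluster[of 1 id y] by (auto simp: strict_mono_def)
  qed
  then obtain x1 where x1: "1 \<le> u x1" ..
  have "u \<in> F1_USCG"
  proof -
    have "cut u \<alpha> \<noteq> {}" if "0 < \<alpha>" "\<alpha> \<le> 1" for \<alpha>
      using x1 that in_cut_iff[of \<alpha> x1 u] by fastforce
    moreover have "x1 \<in> cut u 0"
      using x1 closure_subset[of "{x. 0 < u x}"] by (force simp: cut_def)
    moreover have "closed (cut u 0)"
      by (simp add: cut_def)
    ultimately show ?thesis
      using u_bounds closed_cut compact_cut
      by (auto simp: F1_USCG_def F1_USC_def fuzzy_set_def less_eq_real_def)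
  qed
  moreover have "\<forall>\<^sub>F n in sequentially. endo_near e (\<sigma> n) u \<and> endo_near e u (\<sigma> n)" if "0 < e" for e
  proof -
    define d where "d = e / 3"
    have "0 < d" using \<open>0 < e\<close> by (simp add: d_def)
    obtain N where N: "\<And>m n. m \<ge> N \<Longrightarrow> n \<ge> N \<Longrightarrow> endo_near d (\<sigma> m) (\<sigma> n)"
      using Cauchy \<open>0 < d\<close> unfolding endo_Cauchy_def by metis
    have "endo_near e (\<sigma> n) u" if "n \<ge> N" for n
      unfolding endo_near_def
    proof
      fix x
      show "\<exists>y. dist x y < e \<and> \<sigma> n x - e < u y"
      proof (cases "\<sigma> n x < e")
        case True
        then show ?thesis
          using u_bounds[of x] \<open>0 < e\<close> by (intro exI[of _ x]) auto
      next
        case False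
        let ?t = "\<sigma> n x - d"
        have t: "0 < ?t" "?t \<le> 1"
          using False \<open>0 < e\<close> bounds(2)[of n x] by (auto simp: d_def)
        have "\<forall>k. \<exists>y. dist x y < d \<and> ?t \<le> \<sigma> (N + k) y"
          using N[OF \<open>n \<ge> N\<close>] unfolding endo_near_def by (meson le_add1 less_imp_le)
        then obtain y where y: "\<And>k. dist x (y k) < d" "\<And>k. ?t \<le> \<sigma> (N + k) (y k)"
          by metis
        obtain z s where z: "(y \<circ> s) \<longlonglongrightarrow> z" "?t \<le> u z"
          using cluster[OF t, of "\<lambda>k. N + k" y] y(2) by (auto simp: strict_mono_def)
        have "(\<lambda>k. dist x ((y \<circ> s) k)) \<longlonglongrightarrow> dist x z"
          using z(1) by (intro tendsto_dist tendsto_const)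
        then have "dist x z \<le> d"
          by (rule LIMSEQ_le_const2) (auto intro!: less_imp_le y(1))
        then have "dist x z < e \<and> \<sigma> n x - e < u z"
          using z(2) \<open>0 < d\<close> by (simp add: d_def)
        then show ?thesis ..
      qed
    qed
    moreover have "endo_near e u (\<sigma> n)" if "n \<ge> N" for n
      unfolding endo_near_def
    proof
      fix x
      have "in_lower_limit \<sigma> (u x) x"
        using u_iff[of "u x" x] u_bounds[of x] by simp
      then have "\<forall>\<^sub>F m in sequentially. \<exists>y. dist x y < d \<and> u x - d < \<sigma> m y"
        using \<open>0 < d\<close> by (rule in_lower_limitD)
      then obtain m y where m: "m \<ge> N" and y: "dist x y < d" "u x - d < \<sigma> m y"
        unfolding eventually_sequentially by (metis nle_le)
      obtain z where z: "dist y z < d" "\<sigma> m y - d < \<sigma> n z"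
        using N[OF m \<open>n \<ge> N\<close>] unfolding endo_near_def by blast
      have "dist x z < e \<and> u x - e < \<sigma> n z"
        using y z dist_triangle[of x z y] \<open>0 < d\<close> unfolding d_def by linarith
      then show "\<exists>y. dist x y < e \<and> u x - e < \<sigma> n y" ..
    qed
    ultimately show ?thesis
      by (intro eventually_sequentiallyI[of N]) simp
  qed
  ultimately show ?thesis
    by blast
qed

section \<open>Total boundedness\<close>

text \<open>
  A discretized endograph: the heights, in steps of \<open>d\<close>, that \<open>u\<close> reaches near each node in \<open>F\<close>. The
  bound on \<open>k\<close> amounts to \<open>k * d \<le> 1\<close>; a fuzzy set reaches no greater height, and the bound leaves
  finitely many codes when \<open>F\<close> is finite.
\<close>
definition endo_code :: "real \<Rightarrow> 'a::metric_space set \<Rightarrow> ('a \<Rightarrow> real) \<Rightarrow> ('a \<times> nat) set" where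
  "endo_code d F u = {(f, k). f \<in> F \<and> k \<le> nat \<lfloor>1/d\<rfloor> \<and> (\<exists>y\<in>ball f d. of_nat k * d \<le> u y)}"

text \<open>
  A point of the endograph of \<open>u\<close> at height below \<open>d\<close> is close to the base \<open>X \<times> {0}\<close>, which belongs to
  every endograph. A higher one lies in a cell of the grid, and \<open>v\<close> reaches the same cell.
\<close>
lemma endo_near_of_code_subset:
  assumes "0 < d" and nonneg: "\<And>x. 0 \<le> v x" and le1: "\<And>x. u x \<le> 1"
    and cover: "{x. d \<le> u x} \<subseteq> (\<Union>f\<in>F. ball f d)"
    and code: "endo_code d F u \<subseteq> endo_code d F v"
  shows "endo_near (2 * d) u v"
  unfolding endo_near_def
proof
  fix x
  show "\<exists>y. dist x y < 2 * d \<and> u x - 2 * d < v y"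
  proof (cases "u x < d")
    case True
    then show ?thesis
      using nonneg[of x] \<open>0 < d\<close> by (intro exI[of _ x]) auto
  next
    case False
    then obtain f where f: "f \<in> F" "x \<in> ball f d"
      using cover by force
    define k where "k = nat \<lfloor>u x / d\<rfloor>"
    have "0 \<le> u x / d"
      using False \<open>0 < d\<close> by simp
    then have k: "of_nat k \<le> u x / d" "u x / d < of_nat k + 1"
      unfolding k_def by linarith+
    then have kd: "of_nat k * d \<le> u x" "u x < of_nat k * d + d"
      using \<open>0 < d\<close> by (simp_all add: field_simps)
    have "k \<le> nat \<lfloor>1/d\<rfloor>"
      unfolding k_def using le1[of x] \<open>0 < d\<close> by (intro nat_mono floor_mono divide_right_mono) auto
    then have "(f, k) \<in> endo_code d F u"
      using f kd by (auto simp: endo_code_def)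
    then obtain y where y: "y \<in> ball f d" "of_nat k * d \<le> v y"
      using code unfolding endo_code_def by blast
    have "dist x y < 2 * d \<and> u x - 2 * d < v y"
      using f y kd \<open>0 < d\<close> dist_triangle3[of x y f] by auto
    then show ?thesis ..
  qed
qed

text \<open>
  Members of \<open>U\<close> with the same code are within \<open>4 * d\<close> of each other, and there are finitely many codes.
\<close>
lemma mtotally_bounded_of_level_unions:
  fixes U :: "('a::metric_space \<Rightarrow> real) set"
  assumes sub: "U \<subseteq> F1_USCG"
    and rc: "\<And>\<alpha>. 0 < \<alpha> \<Longrightarrow> \<alpha> \<le> 1 \<Longrightarrow> relatively_compactin euclidean (level_union U \<alpha>)"
  shows "Metric_space.mtotally_bounded F1_USCG H_end U"
proof -
  interpret E: Metric_space "F1_USCG :: ('a \<Rightarrow> real) set" H_end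
    by (rule Metric_space_F1_USCG)
  show ?thesis
    unfolding E.mtotally_bounded_def
  proof (intro allI impI)
    fix e :: real assume "0 < e"
    define d where "d = min 1 (e/5)"
    have d: "0 < d" "d \<le> 1" "4 * d < e"
      using \<open>0 < e\<close> by (auto simp: d_def)
    have "compact (closure (level_union U d))"
      using rc d by (simp add: relatively_compactin_euclidean)
    then obtain F where F: "finite F" "closure (level_union U d) \<subseteq> (\<Union>f\<in>F. ball f d)"
      using d(1) unfolding compact_eq_totally_bounded by metis
    have near: "H_end u v < e" if uv: "u \<in> U" "v \<in> U" "endo_code d F u = endo_code d F v" for u v
    proof -
      have mem: "u \<in> F1_USCG" "v \<in> F1_USCG"
        using sub uv by auto
      have cover: "{x. d \<le> w x} \<subseteq> (\<Union>f\<in>F. ball f d)" if "w \<in> U" for w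
        using F(2) closure_subset[of "level_union U d"] in_level_unionI[OF d(1) that] by fast
      have "endo_near (2 * d) u v" "endo_near (2 * d) v u"
        using uv d(1) cover F1_USCG_bounds[OF mem(1)] F1_USCG_bounds[OF mem(2)]
        by (auto intro!: endo_near_of_code_subset)
      then have "H_end u v \<le> 2 * (2 * d)"
        using mem d(1) by (intro H_end_le_of_endo_near) auto
      then show ?thesis
        using d(3) by simp
    qed
    have "endo_code d F ` U \<subseteq> Pow (F \<times> {..nat \<lfloor>1/d\<rfloor>})"
      by (auto simp: endo_code_def)
    then have fin: "finite (endo_code d F ` U)"
      using F(1) finite_subset by blast
    \<comment> \<open>One representative for each code is an \<open>e\<close>-net.\<close>
    let ?rep = "inv_into U (endo_code d F)"
    show "\<exists>K. finite K \<and> K \<subseteq> U \<and> U \<subseteq> (\<Union>u\<in>K. E.mball u e)"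
    proof (intro exI conjI subsetI)
      show "finite (?rep ` endo_code d F ` U)"
        using fin by simp
      show rep: "w \<in> U" if "w \<in> ?rep ` endo_code d F ` U" for w
        using that by (auto intro: inv_into_into)
      show "v \<in> (\<Union>u\<in>?rep ` endo_code d F ` U. E.mball u e)" if v: "v \<in> U" for v
      proof -
        have "?rep (endo_code d F v) \<in> U"
          "endo_code d F (?rep (endo_code d F v)) = endo_code d F v"
          using v by (simp_all add: inv_into_into f_inv_into_f)
        then have "v \<in> E.mball (?rep (endo_code d F v)) e"
          using near v sub by auto
        then show ?thesis
          using v by blast
      qed
    qed
  qed
qed

section \<open>The characterization\<close>

theorem theorem7p9:
  fixes U :: "('a::metric_space \<Rightarrow> real) set"
  assumes "U \<subseteq> F1_USCG"
  shows "relatively_compactin (Metric_space.mtopology F1_USCG H_end) U \<longleftrightarrow>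
    (\<forall>\<alpha>\<in>{0<..1}. relatively_compactin euclidean (level_union U \<alpha>))"
proof
  interpret E: Metric_space "F1_USCG :: ('a \<Rightarrow> real) set" H_end
    by (rule Metric_space_F1_USCG)
  show "\<forall>\<alpha>\<in>{0<..1}. relatively_compactin euclidean (level_union U \<alpha>)"
    if "relatively_compactin E.mtopology U"
    using level_union_relatively_compact[OF that] by simp
  assume "\<forall>\<alpha>\<in>{0<..1}. relatively_compactin euclidean (level_union U \<alpha>)"
  then have rc: "relatively_compactin euclidean (level_union U \<alpha>)" if "0 < \<alpha>" "\<alpha> \<le> 1" for \<alpha>
    using that by simp
  show "relatively_compactin E.mtopology U"
    unfolding E.relatively_compactin_sequentially
  proof (intro conjI allI impI)
    fix \<sigma> :: "nat \<Rightarrow> 'a \<Rightarrow> real"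
    assume \<sigma>: "range \<sigma> \<subseteq> U"
    then obtain r where r: "strict_mono r" "E.MCauchy (\<sigma> \<circ> r)"
      using mtotally_bounded_of_level_unions[OF assms rc]
      unfolding E.mtotally_bounded_sequentially by (metis (no_types))
    let ?\<tau> = "\<sigma> \<circ> r"
    have mem: "?\<tau> n \<in> F1_USCG" for n
      using \<sigma> assms by auto
    have "endo_Cauchy ?\<tau>"
      unfolding endo_Cauchy_def
      using r(2) mem endo_near_of_H_end_less unfolding E.MCauchy_def by metis
    moreover have "relatively_compactin euclidean (level_union (range ?\<tau>) \<alpha>)"
      if "0 < \<alpha>" "\<alpha> \<le> 1" for \<alpha>
    proof -
      have "level_union (range ?\<tau>) \<alpha> \<subseteq> level_union U \<alpha>"
        using \<sigma> by (fastforce simp: level_union_def)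
      then show ?thesis
        using rc[OF that] unfolding relatively_compactin_euclidean_sequentially
        by (meson order_trans)
    qed
    ultimately obtain u where u: "u \<in> F1_USCG"
      and lim: "\<And>e. 0 < e \<Longrightarrow> \<forall>\<^sub>F n in sequentially. endo_near e (?\<tau> n) u \<and> endo_near e u (?\<tau> n)"
      using endo_Cauchy_convergent[of ?\<tau>] mem by blast
    have "limitin E.mtopology ?\<tau> u sequentially"
      unfolding E.limitin_metric
    proof (intro conjI allI impI u)
      fix e :: real assume "0 < e"
      then have "\<forall>\<^sub>F n in sequentially. endo_near (e/3) (?\<tau> n) u \<and> endo_near (e/3) u (?\<tau> n)"
        by (intro lim) simp
      then show "\<forall>\<^sub>F n in sequentially. ?\<tau> n \<in> F1_USCG \<and> H_end (?\<tau> n) u < e"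
      proof (rule eventually_mono)
        fix n assume "endo_near (e/3) (?\<tau> n) u \<and> endo_near (e/3) u (?\<tau> n)"
        then have "H_end (?\<tau> n) u \<le> 2 * (e/3)"
          using \<open>0 < e\<close> by (intro H_end_le_of_endo_near mem u) auto
        then show "?\<tau> n \<in> F1_USCG \<and> H_end (?\<tau> n) u < e"
          using mem \<open>0 < e\<close> by simp
      qed
    qed
    then show "\<exists>u r. strict_mono r \<and> limitin E.mtopology (\<sigma> \<circ> r) u sequentially"
      using r(1) by blast
  qed (rule assms)
qed

end
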